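(* Let $0<q<p\le1$, let $k$ be a positive integer and $n\ge1$. Then $$\widehat{C}_{n,p,q}^{(k)}(x)=(-1)^{n}\sum_{m=0}^nS_1(n,m)\sum_{l=0}^m\binom ml \frac{(-x)^l}{[m-l+1]_{p,q}^k}=(-1)^n\sum_{m=0}^nS_1(n,m,-x)\frac{1}{[m+1]_{p,q}^k}.$$ Moreover, as formal power series in $t$, $$(1+t)^x\,\mathrm{Lif}_{k,p,q}(-\ln(1+t))=\sum_{n=0}^\infty \widehat{C}_{n,p,q}^{(k)}(x)\frac{t^n}{n!},$$ where $\mathrm{Lif}_{k,p,q}(t)=\sum_{n=0}^\infty\frac{t^n}{n!\,[n+1]_{p,q}^k}$.
   Context: $[n]_{p,q}=\frac{p^n-q^n}{p-q}$. For $0<q<p\le1$ the $(p,q)$-integral is $\int_0^x f(t)\,d_{p,q}t=(p-q)x\sum_{n=0}^\infty \frac{q^n}{p^{n+1}}f\!\left(\frac{q^n}{p^{n+1}}x\right)$. Let $(y)_n=y(y-1)\cdots(y-n+1)$, $(y)_0=1$. The $(p,q)$-poly-Cauchy polynomials of the second kind are $\widehat{C}_{n,p,q}^{(k)}(x)=\int_0^1\cdots\int_0^1 (-t_1\cdots t_k+x)_n\,d_{p,q}t_1\cdots d_{p,q}t_k$ ($k$-fold). The unsigned Stirling numbers of the first kind $S_1(n,m)$ are defined by $x(x+1)\cdots(x+n-1)=\sum_{m=0}^n S_1(n,m)x^m$. The weighted Stirling numbers of the first kind are defined by $\frac{(1-t)^{-x}(-\ln(1-t))^m}{m!}=\sum_{n\ge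 m}S_1(n,m,x)\frac{t^n}{n!}$. *)

theory Defs
  imports Complex_Main "HOL-Computational_Algebra.Formal_Power_Series" "HOL-Combinatorics.Stirling"
begin

definition pq_num :: "real \<Rightarrow> real \<Rightarrow> nat \<Rightarrow> real" where
  "pq_num p q n = (p ^ n - q ^ n) / (p - q)"

definition pq_integral :: "real \<Rightarrow> real \<Rightarrow> real \<Rightarrow> (real \<Rightarrow> real) \<Rightarrow> real" where
  "pq_integral p q x f =
     (p - q) * x * (\<Sum>n. q ^ n / p ^ (n + 1) * f (q ^ n / p ^ (n + 1) * x))"

text \<open>
  The integrand takes the list \<open>[t\<^sub>1, \<dots>, t\<^sub>k]\<close> as argument;
  \<open>t\<^sub>1\<close> is the innermost and \<open>t\<^sub>k\<close> the outermost integration variable.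
\<close>

primrec pq_multi_integral :: "real \<Rightarrow> real \<Rightarrow> nat \<Rightarrow> (real list \<Rightarrow> real) \<Rightarrow> real" where
  "pq_multi_integral p q 0 F = F []"
| "pq_multi_integral p q (Suc k) F =
     pq_integral p q 1 (\<lambda>t. pq_multi_integral p q k (\<lambda>ts. F (ts @ [t])))"

definition falling_fact :: "real \<Rightarrow> nat \<Rightarrow> real" where
  "falling_fact y n = (\<Prod>i<n. y - real i)"

definition pq_poly_cauchy2 :: "real \<Rightarrow> real \<Rightarrow> nat \<Rightarrow> nat \<Rightarrow> real \<Rightarrow> real" where
  "pq_poly_cauchy2 p q k n x =
     pq_multi_integral p q k (\<lambda>ts. falling_fact (- prod_list ts + x) n)"

text \<open>
  The unsigned Stirling numbers of the first kind are the library's \<^const>\<open>stirling\<close>; their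
  defining expansion of the rising factorial is the library fact \<open>stirling_pochhammer\<close>.

  For the weighted numbers, \<^term>\<open>fps_binomial a\<close> is the series $(1+t)^a$ and
  \<^term>\<open>fps_ln 1\<close> is the series $\ln(1+t)$, so that composing with \<open>- fps_X\<close> gives
  $(1-t)^a$ and $\ln(1-t)$.
\<close>

definition weighted_stirling1 :: "nat \<Rightarrow> nat \<Rightarrow> real \<Rightarrow> real" where
  "weighted_stirling1 n m x =
     fact n * fps_nth
       (fps_const (1 / fact m) * (fps_binomial (- x) oo (- fps_X)) *
         (- (fps_ln 1 oo (- fps_X))) ^ m) n"

definition pq_Lif :: "nat \<Rightarrow> real \<Rightarrow> real \<Rightarrow> real fps" where
  "pq_Lif k p q = Abs_fps (\<lambda>n. 1 / (fact n * pq_num p q (n + 1) ^ k))"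

end

theory Submission
  imports Defs
begin

text \<open>
  The \<open>k\<close>-fold \<open>(p,q)\<close>-integral sends \<open>(t\<^sub>1 \<cdots> t\<^sub>k)\<^sup>m\<close> to \<open>1 / [m+1]\<^sup>k\<close>, so everything reduces to
  expanding \<open>(x - t)\<^sub>n\<close> in powers of \<open>t\<close>. Stirling's expansion of \<open>(-1)\<^sup>n (t - x)(t - x + 1) \<cdots>\<close>
  followed by the binomial theorem gives the first formula. Reading \<open>(x - t)\<^sub>n / n!\<close> as the \<open>n\<close>-th
  coefficient of \<open>(1+T)\<^sup>x exp (- t ln (1+T))\<close> gives the second formula and the generating function.
\<close>

unbundle fps_syntax

text \<open>Collecting powers makes the terms geometric with ratio
  \<open>(q / p) ^ (m + 1) < 1\<close> and first term \<open>1 / p ^ (m + 1)\<close>. The factor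
  \<open>p - q\<close> cancels later against the prefactor of \<open>pq_integral\<close>.\<close>

lemma pq_moment_sums:
  fixes p q :: real
  assumes "0 < q" "q < p"
  shows "(\<lambda>n. q ^ n / p ^ (n + 1) * (q ^ n / p ^ (n + 1)) ^ m) sums
           (1 / ((p - q) * pq_num p q (m + 1)))"
proof -
  have p: "p > 0" using assms by simp
  have lt: "q ^ (m + 1) < p ^ (m + 1)"
    using assms by (intro power_strict_mono) auto
  have "norm ((q / p) ^ (m + 1)) < 1"
    using assms p lt by (simp add: power_divide)
  then have "(\<lambda>n. 1 / p ^ (m + 1) * ((q / p) ^ (m + 1)) ^ n) sums
      (1 / p ^ (m + 1) * (1 / (1 - (q / p) ^ (m + 1))))"
    by (intro sums_mult geometric_sums)
  moreover have "1 / p ^ (m + 1) * ((q / p) ^ (m + 1)) ^ n =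
      q ^ n / p ^ (n + 1) * (q ^ n / p ^ (n + 1)) ^ m" for n
  proof -
    have "((q / p) ^ (m + 1)) ^ n = (q / p) ^ n * ((q / p) ^ n) ^ m"
      by (simp only: power_mult [symmetric] power_add [symmetric]) (simp add: algebra_simps)
    then show ?thesis by (simp add: power_divide power_mult_distrib)
  qed
  moreover have "1 / p ^ (m + 1) * (1 / (1 - (q / p) ^ (m + 1))) =
      1 / ((p - q) * pq_num p q (m + 1))"
  proof -
    have "p ^ (m + 1) * (1 - (q / p) ^ (m + 1)) = p ^ (m + 1) - q ^ (m + 1)"
      using p by (simp add: power_divide right_diff_distrib del: power_Suc)
    moreover have "(p - q) * pq_num p q (m + 1) = p ^ (m + 1) - q ^ (m + 1)"
      using assms by (simp add: pq_num_def)
    ultimately show ?thesis by (simp only: divide_divide_eq_left times_divide_times_eq mult_1)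
  qed
  ultimately show ?thesis by simp
qed

lemma pq_integral_sum_power:
  fixes p q :: real
  assumes "0 < q" "q < p"
  shows "pq_integral p q 1 (\<lambda>t. \<Sum>i\<in>I. c i * t ^ e i) = (\<Sum>i\<in>I. c i / pq_num p q (e i + 1))"
proof -
  let ?w = "\<lambda>n. q ^ n / p ^ (n + 1)"
  have "(\<lambda>n. \<Sum>i\<in>I. c i * (?w n * ?w n ^ e i)) sums
      (\<Sum>i\<in>I. c i * (1 / ((p - q) * pq_num p q (e i + 1))))"
    by (intro sums_sum sums_mult pq_moment_sums assms)
  also have "(\<lambda>n. \<Sum>i\<in>I. c i * (?w n * ?w n ^ e i)) =
      (\<lambda>n. ?w n * (\<Sum>i\<in>I. c i * (?w n * 1) ^ e i))"
    by (simp only: sum_distrib_left mult.left_commute mult_1_right)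
  finally have "pq_integral p q 1 (\<lambda>t. \<Sum>i\<in>I. c i * t ^ e i) =
      (p - q) * (\<Sum>i\<in>I. c i * (1 / ((p - q) * pq_num p q (e i + 1))))"
    unfolding pq_integral_def by (simp only: sums_unique[symmetric] mult_1_right)
  also have "\<dots> = (\<Sum>i\<in>I. c i / pq_num p q (e i + 1))"
    using assms by (simp add: sum_distrib_left)
  finally show ?thesis .
qed

text \<open>Each integration contributes one factor \<open>1 / pq_num p q (e i + 1)\<close>. General
  \<open>I\<close> and \<open>e\<close> cover both sums over pairs \<open>(m, l)\<close> with
  exponent \<open>m - l\<close> and plain sums over \<open>m\<close>.\<close>

lemma pq_multi_integral_sum_power:
  fixes p q :: real
  assumes "0 < q" "q < p"
  shows "pq_multi_integral p q k (\<lambda>ts. \<Sum>i\<in>I. c i * prod_list ts ^ e i) =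
           (\<Sum>i\<in>I. c i / pq_num p q (e i + 1) ^ k)"
proof (induction k arbitrary: c)
  case 0
  show ?case by simp
next
  case (Suc k)
  \<comment> \<open>The outermost variable \<open>t\<close> is constant for the inner integrals, so
    \<open>t ^ e i\<close> is absorbed into the coefficient; hence \<open>c\<close> is arbitrary in
    the induction.\<close>
  have "pq_multi_integral p q k (\<lambda>ts. \<Sum>i\<in>I. c i * prod_list (ts @ [t]) ^ e i) =
      (\<Sum>i\<in>I. c i / pq_num p q (e i + 1) ^ k * t ^ e i)" for t
    using Suc.IH[of "\<lambda>i. c i * t ^ e i"] by (simp add: power_mult_distrib mult_ac)
  then show ?case
    using pq_integral_sum_power[OF assms, where I = I and e = e
        and c = "\<lambda>i. c i / pq_num p q (e i + 1) ^ k"]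
    by (simp add: mult_ac)
qed

lemma falling_fact_conv_gbinomial: "falling_fact y n = fact n * (y gchoose n)"
  by (simp add: falling_fact_def gbinomial_mult_fact atLeast0LessThan)

text \<open>Summing over dependent pairs flattens the double sum to the shape required by
  \<open>pq_multi_integral_sum_power\<close>.\<close>

lemma falling_fact_stirling:
  "falling_fact (x - t) n =
     (\<Sum>(m, l)\<in>(SIGMA m:{0..n}. {0..m}).
        (-1) ^ n * (real (stirling n m) * (real (m choose l) * (- x) ^ l)) * t ^ (m - l))"
proof -
  have "falling_fact (x - t) n = (-1) ^ n * pochhammer (- x + t) n"
    by (simp add: falling_fact_conv_gbinomial gbinomial_pochhammer)
  also have "pochhammer (- x + t) n = (\<Sum>m=0..n. real (stirling n m) * (- x + t) ^ m)"
    by (simp add: stirling_pochhammer atLeast0AtMost)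
  also have "\<dots> = (\<Sum>m=0..n. real (stirling n m) *
      (\<Sum>l=0..m. real (m choose l) * (- x) ^ l * t ^ (m - l)))"
    by (simp only: binomial_ring atLeast0AtMost)
  finally show ?thesis
    by (simp add: sum_distrib_left sum.Sigma case_prod_unfold mult.assoc)
qed

text \<open>Both series solve \<open>(1 + X) y' = a y\<close> with constant term 1, which determines
  the solution.\<close>

lemma fps_exp_compose_ln:
  fixes a :: "'a :: field_char_0"
  shows "fps_exp a oo fps_ln 1 = fps_binomial a"
proof -
  have "fps_deriv (fps_exp a oo fps_ln 1) = fps_const a * (fps_exp a oo fps_ln 1) / (1 + fps_X)"
    by (simp add: fps_compose_deriv fps_ln_deriv fps_divide_unit fps_compose_mult_distrib mult.assoc)
  then show ?thesis
    by (subst fps_binomial_ODE_unique' [symmetric]) simp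
qed

lemma fps_mult_compose_nth:
  fixes f A b :: "'a :: comm_ring_1 fps"
  assumes "b $ 0 = 0"
  shows "(f * (A oo b)) $ n = (\<Sum>m=0..n. A $ m * (f * b ^ m) $ n)"
proof -
  have "(A oo b) $ (n - i) = (\<Sum>m=0..n. A $ m * (b ^ m) $ (n - i))" for i
    unfolding fps_compose_nth
    \<comment> \<open>As \<open>b\<close> has no constant term, \<open>b ^ m\<close> vanishes below
      degree \<open>m\<close>. The range can thus be extended from \<open>n - i\<close> to
      \<open>n\<close>, independent of \<open>i\<close>, which permits the swap below.\<close>
    by (rule sum.mono_neutral_left) (auto simp: startsby_zero_power_prefix[OF assms])
  then have "(f * (A oo b)) $ n = (\<Sum>i=0..n. \<Sum>m=0..n. f $ i * (A $ m * (b ^ m) $ (n - i)))"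
    by (simp add: fps_mult_nth sum_distrib_left)
  also have "\<dots> = (\<Sum>m=0..n. A $ m * (f * b ^ m) $ n)"
    by (subst sum.swap) (simp add: fps_mult_nth sum_distrib_left mult_ac)
  finally show ?thesis .
qed

text \<open>The defining series is a series in \<open>1 + X\<close> with \<open>- fps_X\<close>
  substituted, which multiplies the \<open>n\<close>-th coefficient by
  \<open>(-1) ^ n\<close>.\<close>

lemma weighted_stirling1_minus:
  "weighted_stirling1 n m (- x) =
     (-1) ^ n * (fact n / fact m) * (fps_binomial x * (- fps_ln 1) ^ m) $ n"
proof -
  have "fps_const (1 / fact m) * (fps_binomial x oo - fps_X) * (- (fps_ln 1 oo - fps_X)) ^ m =
      (fps_const (1 / fact m) * (fps_binomial x * (- fps_ln 1) ^ m)) oo (- fps_X :: real fps)"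
    by (simp add: fps_compose_mult_distrib fps_compose_power mult.assoc
        flip: fps_compose_uminus)
  then show ?thesis
    by (simp add: weighted_stirling1_def fps_compose_uminus')
qed

lemma falling_fact_weighted_stirling1:
  "falling_fact (x - t) n = (\<Sum>m=0..n. (-1) ^ n * weighted_stirling1 n m (- x) * t ^ m)"
proof -
  \<comment> \<open>Moving the sign into the exponential gives
    \<open>fps_exp (- t) oo fps_ln 1\<close>, that is, \<open>fps_binomial (- t)\<close>.\<close>
  have "fps_exp t oo (- fps_ln 1) = (fps_exp t oo - fps_X) oo fps_ln 1"
    by (subst fps_compose_assoc [symmetric]) (simp_all add: fps_compose_uminus)
  then have "fps_binomial (x - t) = fps_binomial x * (fps_exp t oo (- fps_ln 1))"
    using fps_binomial_add_mult[of x "- t"] by (simp add: fps_exp_compose_ln)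
  then have "(x - t) gchoose n = (\<Sum>m=0..n. fps_exp t $ m * (fps_binomial x * (- fps_ln 1) ^ m) $ n)"
    by (simp add: fps_mult_compose_nth flip: fps_binomial_nth del: fps_exp_nth)
  then show ?thesis
    by (simp add: falling_fact_conv_gbinomial weighted_stirling1_minus sum_distrib_left
        field_simps flip: power_mult_distrib)
qed

lemma pq_poly_cauchy2_stirling:
  assumes "0 < q" "q < p"
  shows "pq_poly_cauchy2 p q k n x =
    (-1) ^ n * (\<Sum>m=0..n. real (stirling n m) *
      (\<Sum>l=0..m. real (m choose l) * (- x) ^ l / pq_num p q (m - l + 1) ^ k))"
  using pq_multi_integral_sum_power[OF assms, where k = k and I = "SIGMA m:{0..n}. {0..m}"
      and c = "\<lambda>(m, l). (-1) ^ n * (real (stirling n m) * (real (m choose l) * (- x) ^ l))"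
      and e = "\<lambda>(m, l). m - l"]
  by (simp add: pq_poly_cauchy2_def falling_fact_stirling case_prod_unfold sum_distrib_left
      sum.Sigma)

lemma pq_poly_cauchy2_weighted_stirling1:
  assumes "0 < q" "q < p"
  shows "pq_poly_cauchy2 p q k n x =
    (-1) ^ n * (\<Sum>m=0..n. weighted_stirling1 n m (- x) * (1 / pq_num p q (m + 1) ^ k))"
  using pq_multi_integral_sum_power[OF assms, where k = k and I = "{0..n}"
      and c = "\<lambda>m. (-1) ^ n * weighted_stirling1 n m (- x)" and e = "\<lambda>m. m"]
  by (simp add: pq_poly_cauchy2_def falling_fact_weighted_stirling1 sum_distrib_left)

text \<open>Integration replaces \<open>t ^ m\<close> by \<open>1 / pq_num p q (m + 1) ^ k\<close>,
  which turns the coefficients of \<open>fps_exp t\<close> into those of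
  \<open>pq_Lif k p q\<close>.\<close>

lemma pq_poly_cauchy2_generating_function:
  assumes "0 < q" "q < p"
  shows "fps_binomial x * (pq_Lif k p q oo (- fps_ln 1)) =
           Abs_fps (\<lambda>n. pq_poly_cauchy2 p q k n x / fact n)"
proof (rule fps_ext)
  fix n
  have "(fps_binomial x * (pq_Lif k p q oo (- fps_ln 1))) $ n =
      (\<Sum>m=0..n. 1 / (fact m * pq_num p q (m + 1) ^ k) * (fps_binomial x * (- fps_ln 1) ^ m) $ n)"
    by (simp add: fps_mult_compose_nth pq_Lif_def)
  also have "\<dots> = pq_poly_cauchy2 p q k n x / fact n"
    unfolding pq_poly_cauchy2_weighted_stirling1[OF assms] weighted_stirling1_minus
      sum_distrib_left sum_divide_distrib
    \<comment> \<open>The two signs \<open>(-1) ^ n\<close> merge into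
      \<open>((-1) * (-1)) ^ n = 1\<close>.\<close>
    by (rule sum.cong) (simp_all flip: power_mult_distrib)
  finally show "(fps_binomial x * (pq_Lif k p q oo (- fps_ln 1))) $ n =
      Abs_fps (\<lambda>n. pq_poly_cauchy2 p q k n x / fact n) $ n"
    by simp
qed

theorem theorem12:
  fixes p q x :: real and k :: nat
  assumes "0 < q" and "q < p" and "p \<le> 1" and "k \<ge> 1"
  shows "(\<forall>n\<ge>1.
            pq_poly_cauchy2 p q k n x =
              (-1) ^ n * (\<Sum>m=0..n. real (stirling n m) *
                (\<Sum>l=0..m. real (m choose l) * (- x) ^ l / pq_num p q (m - l + 1) ^ k)) \<and>
            (-1) ^ n * (\<Sum>m=0..n. real (stirling n m) *
                (\<Sum>l=0..m. real (m choose l) * (- x) ^ l / pq_num p q (m - l + 1) ^ k)) =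
              (-1) ^ n * (\<Sum>m=0..n. weighted_stirling1 n m (- x) * (1 / pq_num p q (m + 1) ^ k)))
         \<and> fps_binomial x * (pq_Lif k p q oo (- fps_ln 1)) =
             Abs_fps (\<lambda>n. pq_poly_cauchy2 p q k n x / fact n)"
  using pq_poly_cauchy2_stirling[OF assms(1,2)] pq_poly_cauchy2_weighted_stirling1[OF assms(1,2)]
    pq_poly_cauchy2_generating_function[OF assms(1,2)]
  by metis

end
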